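(* For every $n\ge 5$ (i.e. whenever $\{2,n-1\}$ is $n$-admissible), $$\#P(\{2,n-1\};n)=(n-1)(n-4)\,2^{n-3},$$ that is, the polynomial $p(\{2,n-1\};n)$ equals $(n-1)(n-4)$.
   Context: For a permutation $\pi=a_1\ldots a_n$ of $\{1,\ldots,n\}$, an index $i$ is a peak if $a_{i-1}<a_i>a_{i+1}$. $P(S;n)$ is the set of permutations of $\{1,\dots,n\}$ whose set of peaks is exactly $S$. For sets $S$ depending on $n$, $p(S;n)$ denotes the polynomial with $\#P(S;n)=p(S;n)2^{n-\#S-1}$ for all $n$ with $\#P(S;n)\neq0$. *)

theory Defs
  imports "HOL-Combinatorics.Permutations" "HOL-Computational_Algebra.Polynomial"
begin

text \<open>
  A permutation \<open>a\<^sub>1 \<dots> a\<^sub>n\<close> of \<open>{1, \<dots>, n}\<close> is a function \<open>\<pi>\<close> with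
  \<open>\<pi> permutes {1..n}\<close> and \<open>a\<^sub>i = \<pi> i\<close>. A peak needs both neighbours \<open>a\<^bsub>i-1\<^esub>\<close> and
  \<open>a\<^bsub>i+1\<^esub>\<close>, hence the bounds \<open>1 < i < n\<close>.
\<close>

definition peaks :: "nat \<Rightarrow> (nat \<Rightarrow> nat) \<Rightarrow> nat set" where
  "peaks n \<pi> = {i. 1 < i \<and> i < n \<and> \<pi> (i - 1) < \<pi> i \<and> \<pi> i > \<pi> (i + 1)}"

definition peak_perms :: "nat set \<Rightarrow> nat \<Rightarrow> (nat \<Rightarrow> nat) set" where
  "peak_perms S n = {\<pi>. \<pi> permutes {1..n} \<and> peaks n \<pi> = S}"

definition admissible :: "nat set \<Rightarrow> nat \<Rightarrow> bool" where
  "admissible S n \<longleftrightarrow> peak_perms S n \<noteq> {}"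

text \<open>
  \<open>S\<close> is a family of sets depending on \<open>n\<close>, and \<open>N\<close> is the set of those \<open>n\<close> for which
  \<open>S n\<close> is a member of the family in the intended sense: a description such as
  \<open>{2, n - 1}\<close> degenerates for small \<open>n\<close>, e.g. to the one-element set \<open>{2}\<close> for \<open>n = 3\<close>.
\<close>

definition is_peak_polynomial :: "nat set \<Rightarrow> (nat \<Rightarrow> nat set) \<Rightarrow> real poly \<Rightarrow> bool" where
  "is_peak_polynomial N S p \<longleftrightarrow>
     (\<forall>n\<in>N. card (peak_perms (S n) n) \<noteq> 0 \<longrightarrow>
        real (card (peak_perms (S n) n)) = poly p (real n) * 2 ^ (n - card (S n) - 1))"

end

theory Submission
  imports Defs
begin

text \<open>
  Delete the largest letter \<open>M\<close> of a word \<open>us @ M # vs\<close>. An interior \<open>M\<close> is a peak, and a neighbour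
  of \<open>M\<close> is never one, so the peaks of the word are those of \<open>us\<close>, those of \<open>vs\<close>, and the position
  of \<open>M\<close> unless \<open>M\<close> stands at an end. With no peaks, \<open>M\<close> is first or last, whence \<open>2 ^ (m - 1)\<close>
  words of length \<open>m\<close>. If the second position is the only peak, \<open>M\<close> is second, with a free first letter
  and a peakless rest, or last; this recursion gives \<open>(m - 2) * 2 ^ (m - 2)\<close> words. If the peaks are
  the second and the penultimate position, \<open>M\<close> occupies one of these, next to a free end letter, and
  the other \<open>n - 2\<close> letters form a word of the preceding kind or its reversal, so there are
  \<open>2 * (n - 1) * ((n - 4) * 2 ^ (n - 4))\<close> words.
\<close>

section \<open>Peaks of words\<close>

text \<open>List positions start at 0, so position \<open>i\<close> here is position \<open>i + 1\<close> in \<^const>\<open>peaks\<close>.\<close>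

definition list_peaks :: "nat list \<Rightarrow> nat set" where
  "list_peaks xs =
     {i. 0 < i \<and> i + 1 < length xs \<and> xs ! (i - 1) < xs ! i \<and> xs ! i > xs ! (i + 1)}"

text \<open>The alphabet is arbitrary because the recursions delete letters from it; only the
  transfer to permutations takes \<open>A = {1..n}\<close>.\<close>

definition peak_lists :: "nat set \<Rightarrow> nat set \<Rightarrow> nat list set" where
  "peak_lists S A = {xs. distinct xs \<and> set xs = A \<and> list_peaks xs = S}"

lemma list_peaks_short: "length xs \<le> 2 \<Longrightarrow> list_peaks xs = {}"
  by (auto simp: list_peaks_def)

lemma list_peaks_bounds: "i \<in> list_peaks xs \<Longrightarrow> 0 < i \<and> i + 1 < length xs"
  by (simp add: list_peaks_def)

lemma list_peaks_split_max:
  assumes "\<And>x. x \<in> set us \<union> set vs \<Longrightarrow> x < M"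
  shows "list_peaks (us @ M # vs) = list_peaks us \<union>
    (if us \<noteq> [] \<and> vs \<noteq> [] then {length us} else {}) \<union> (\<lambda>i. i + length us + 1) ` list_peaks vs"
proof (rule set_eqI)
  fix i
  let ?l = "length us"
  have less_us: "us ! j < M" if "j < ?l" for j
    using assms that by auto
  have less_vs: "vs ! j < M" if "j < length vs" for j
    using assms that by auto
  \<comment> \<open>Five places for \<open>i\<close>: with its right neighbour inside
    \<open>us\<close>, last in \<open>us\<close>, at \<open>M\<close>, right after \<open>M\<close>,
    further right. The two places next to \<open>M\<close> contribute no peak.\<close>
  consider "i + 1 < ?l" | "i + 1 = ?l" | "i = ?l" | "i = ?l + 1" | j where "i = ?l + 1 + Suc j"
    by (metis add.commute linorder_neqE_nat less_imp_Suc_add Suc_eq_plus1 add_Suc_right Suc_lessI)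
  then show "i \<in> list_peaks (us @ M # vs) \<longleftrightarrow> i \<in> list_peaks us \<union>
    (if us \<noteq> [] \<and> vs \<noteq> [] then {?l} else {}) \<union> (\<lambda>i. i + ?l + 1) ` list_peaks vs"
  proof cases
    case 1
    then show ?thesis
      by (auto simp: list_peaks_def nth_append)
  next
    case 2
    then have "us ! i < M" using less_us by simp
    with 2 show ?thesis
      by (auto simp: list_peaks_def nth_append)
  next
    case 3
    have "us \<noteq> [] \<Longrightarrow> us ! (?l - 1) < M" "vs \<noteq> [] \<Longrightarrow> vs ! 0 < M"
      using less_us less_vs by auto
    with 3 show ?thesis
      by (auto simp: list_peaks_def nth_append)
  next
    case 4
    have "\<not> M < vs ! 0" if "1 < length vs"
      by (rule less_not_sym, rule less_vs) (use that in linarith)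
    with 4 show ?thesis
      by (auto simp: list_peaks_def nth_append)
  next
    case 5
    have "i \<in> list_peaks (us @ M # vs) \<longleftrightarrow> Suc j \<in> list_peaks vs"
      using 5 by (auto simp: list_peaks_def nth_append)
    then show ?thesis
      using 5 by (auto dest: list_peaks_bounds)
  qed
qed

text \<open>Reflection exchanges the two neighbours of a position, and the peak condition is
  symmetric in them.\<close>

lemma list_peaks_rev:
  "list_peaks (rev xs) = (\<lambda>i. length xs - 1 - i) ` list_peaks xs"
proof -
  \<comment> \<open>One inclusion, for every list; applied to \<open>rev xs\<close> it yields the
    other, since the reflection is an involution on positions.\<close>
  have sub: "(\<lambda>i. length xs - 1 - i) ` list_peaks xs \<subseteq> list_peaks (rev xs)" for xs
  proof (rule image_subsetI)
    fix i
    assume "i \<in> list_peaks xs"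
    then have i: "0 < i" "i + 1 < length xs" "xs ! (i - 1) < xs ! i" "xs ! i > xs ! (i + 1)"
      by (auto simp: list_peaks_def)
    have "length xs - Suc (length xs - 1 - i) = i" "length xs - Suc (length xs - 1 - i - 1) = i + 1"
      "length xs - Suc (length xs - 1 - i + 1) = i - 1"
      using i by auto
    then show "length xs - 1 - i \<in> list_peaks (rev xs)"
      using i by (simp add: list_peaks_def rev_nth)
  qed
  show ?thesis
  proof
    show "list_peaks (rev xs) \<subseteq> (\<lambda>i. length xs - 1 - i) ` list_peaks xs"
    proof
      fix i
      assume i: "i \<in> list_peaks (rev xs)"
      then have "length xs - 1 - i \<in> list_peaks xs"
        using sub[of "rev xs"] by auto
      moreover have "i = length xs - 1 - (length xs - 1 - i)"
        using list_peaks_bounds[OF i] by simp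
      ultimately show "i \<in> (\<lambda>i. length xs - 1 - i) ` list_peaks xs"
        by blast
    qed
  qed (rule sub)
qed

section \<open>Words with prescribed peaks, cut at the largest letter\<close>

lemma finite_peak_lists: "finite A \<Longrightarrow> finite (peak_lists S A)"
  by (rule finite_subset[OF _ finite_subset_distinct[of A]]) (auto simp: peak_lists_def)

lemma length_peak_lists: "xs \<in> peak_lists S A \<Longrightarrow> length xs = card A"
  by (auto simp: peak_lists_def distinct_card)

text \<open>The peak set comes out as an equation between sets, so each count reduces to asking
  which positions of \<open>M\<close> are compatible with it; \<open>peak_lists_joinI\<close> is the
  way back.\<close>

lemma peak_lists_splitE:
  assumes "xs \<in> peak_lists S A" "M \<in> A" "\<And>x. x \<in> A \<Longrightarrow> x \<le> M"
  obtains us vs where "xs = us @ M # vs" "distinct us" "distinct vs" "set us \<inter> set vs = {}"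
    "M \<notin> set us \<union> set vs" "A = insert M (set us \<union> set vs)" "length us + length vs + 1 = card A"
    "S = list_peaks us \<union> (if us \<noteq> [] \<and> vs \<noteq> [] then {length us} else {}) \<union>
      (\<lambda>i. i + length us + 1) ` list_peaks vs"
proof -
  have xs: "distinct xs" "set xs = A" "list_peaks xs = S"
    using assms(1) by (auto simp: peak_lists_def)
  then obtain us vs where eq: "xs = us @ M # vs"
    using assms(2) by (metis split_list)
  have "x < M" if "x \<in> set us \<union> set vs" for x
    using assms(3)[of x] that xs eq by (auto simp: order.strict_iff_order)
  note peaks = list_peaks_split_max[OF this]
  show thesis
  proof (rule that[OF eq])
    show "length us + length vs + 1 = card A"
      using length_peak_lists[OF assms(1)] eq by simp
    show "S = list_peaks us \<union> (if us \<noteq> [] \<and> vs \<noteq> [] then {length us} else {}) \<union>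
        (\<lambda>i. i + length us + 1) ` list_peaks vs"
      using peaks xs eq by simp
  qed (use xs eq in auto)
qed

lemma peak_lists_joinI:
  assumes "distinct us" "distinct vs" "set us \<inter> set vs = {}"
    "M \<in> A" "\<And>x. x \<in> A \<Longrightarrow> x \<le> M" "A - {M} = set us \<union> set vs"
    "S = list_peaks us \<union> (if us \<noteq> [] \<and> vs \<noteq> [] then {length us} else {}) \<union>
      (\<lambda>i. i + length us + 1) ` list_peaks vs"
  shows "us @ M # vs \<in> peak_lists S A"
proof -
  have "x < M" if "x \<in> set us \<union> set vs" for x
  proof -
    have "x \<in> A - {M}"
      using assms(6) that by simp
    then show ?thesis
      using assms(5)[of x] by auto
  qed
  then have "list_peaks (us @ M # vs) = S"
    unfolding assms(7) by (rule list_peaks_split_max)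
  moreover have "M \<notin> set us" "M \<notin> set vs" "set us \<subseteq> A" "set vs \<subseteq> A" "A \<subseteq> insert M (set us \<union> set vs)"
    using assms(6) by auto
  ultimately show ?thesis
    using assms(1-4) by (auto simp: peak_lists_def)
qed

text \<open>Serves for words with a freely chosen letter \<open>a\<close> at one end: the word
  determines \<open>a\<close> and the remaining word, so the images are disjoint and each has size
  \<open>c\<close>.\<close>

lemma card_UN_image_inj:
  assumes "finite I" "\<And>a. a \<in> I \<Longrightarrow> finite (B a)" "\<And>a. a \<in> I \<Longrightarrow> card (B a) = c"
    and "\<And>a b x y. f a x = f b y \<Longrightarrow> a = b \<and> x = y"
  shows "card (\<Union>a\<in>I. f a ` B a) = card I * c"
proof -
  have "card (\<Union>a\<in>I. f a ` B a) = (\<Sum>a\<in>I. card (f a ` B a))"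
  proof (rule card_UN_disjoint)
    show "\<forall>a\<in>I. \<forall>b\<in>I. a \<noteq> b \<longrightarrow> f a ` B a \<inter> f b ` B b = {}"
      using assms(4) by blast
  qed (use assms in auto)
  also have "\<dots> = (\<Sum>a\<in>I. c)"
    by (rule sum.cong[OF refl]) (use assms in \<open>auto simp: card_image inj_on_def\<close>)
  finally show ?thesis
    by simp
qed

section \<open>Words without peaks\<close>

lemma card_peak_lists_empty:
  assumes "finite A" "A \<noteq> {}"
  shows "card (peak_lists {} A) = 2 ^ (card A - 1)"
  using assms
proof (induction "card A" arbitrary: A rule: less_induct)
  case less
  define M where "M = Max A"
  have M: "M \<in> A" "\<And>x. x \<in> A \<Longrightarrow> x \<le> M"
    using less.prems by (auto simp: M_def)
  show ?case
  proof (cases "A = {M}")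
    case True
    have "peak_lists {} A = {[M]}"
    proof (intro equalityI subsetI)
      fix xs
      assume "xs \<in> peak_lists {} A"
      from peak_lists_splitE[OF this M] obtain us vs where
        "xs = us @ M # vs" "length us + length vs + 1 = card A" by metis
      then show "xs \<in> {[M]}"
        using True by auto
    qed (use True in \<open>simp add: peak_lists_def list_peaks_short\<close>)
    then show ?thesis
      using True by simp
  next
    case False
    let ?A = "A - {M}" and ?f = "\<lambda>vs. M # vs" and ?g = "\<lambda>us. us @ [M]"
    let ?P = "peak_lists {} ?A"
    have A': "finite ?A" "?A \<noteq> {}" "card ?A = card A - 1"
      using False less.prems M by auto
    have "card A \<noteq> 0"
      using less.prems by simp
    have "card ?A \<noteq> 0"
      using A'(1,2) by (metis card_eq_0_iff)
    then have pow: "card A - 1 = Suc (card ?A - 1)"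
      using A' by simp
    have IH: "card ?P = 2 ^ (card ?A - 1)"
      using A' \<open>card A \<noteq> 0\<close> by (intro less.hyps) auto
    have split: "peak_lists {} A = ?f ` ?P \<union> ?g ` ?P"
    proof (intro equalityI subsetI)
      fix xs
      assume "xs \<in> peak_lists {} A"
      from peak_lists_splitE[OF this M] obtain us vs where
        s: "xs = us @ M # vs" "distinct us" "distinct vs" "M \<notin> set us \<union> set vs"
          "A = insert M (set us \<union> set vs)"
          "{} = list_peaks us \<union> (if us \<noteq> [] \<and> vs \<noteq> [] then {length us} else {}) \<union>
            (\<lambda>i. i + length us + 1) ` list_peaks vs"
        by metis
      \<comment> \<open>Otherwise \<open>length us\<close> would be a peak.\<close>
      then consider "us = []" | "vs = []"
        by (auto split: if_splits)
      then show "xs \<in> ?f ` ?P \<union> ?g ` ?P"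
        using s by cases (auto simp: peak_lists_def)
    next
      fix xs
      assume "xs \<in> ?f ` ?P \<union> ?g ` ?P"
      then obtain ys where ys: "ys \<in> ?P" "xs = [] @ M # ys \<or> xs = ys @ M # []"
        by auto
      have "[] @ M # ys \<in> peak_lists {} A"
        using ys(1) M by (intro peak_lists_joinI) (auto simp: peak_lists_def list_peaks_short)
      moreover have "ys @ M # [] \<in> peak_lists {} A"
        using ys(1) M by (intro peak_lists_joinI) (auto simp: peak_lists_def list_peaks_short)
      ultimately show "xs \<in> peak_lists {} A"
        using ys(2) by auto
    qed
    have "?f ` ?P \<inter> ?g ` ?P = {}"
    proof -
      \<comment> \<open>Since \<open>?A\<close> is nonempty, so is \<open>us\<close>, and its first
        letter would be \<open>M\<close>.\<close>
      have "M # vs \<noteq> us @ [M]" if "us \<in> ?P" for us vs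
        using that A'(2) by (cases us) (auto simp: peak_lists_def)
      then show ?thesis
        by auto
    qed
    then have "card (peak_lists {} A) = card (?f ` ?P) + card (?g ` ?P)"
      unfolding split by (intro card_Un_disjoint) (simp_all add: finite_peak_lists less.prems)
    also have "\<dots> = 2 * card ?P"
      by (simp add: card_image inj_on_def)
    finally show ?thesis
      using IH pow by simp
  qed
qed

section \<open>Words whose only peak is the second position\<close>

text \<open>For \<open>m = card A\<close> and the count \<open>f m\<close>, the two places for the
  largest letter give \<open>f m = (m - 1) * 2 ^ (m - 3) + f (m - 1)\<close> when
  \<open>m > 2\<close>; words of length 2 have no peak, so \<open>f 2 = 0\<close>.\<close>

lemma card_peak_lists_second:
  assumes "finite A" "2 \<le> card A"
  shows "card (peak_lists {1} A) = (card A - 2) * 2 ^ (card A - 2)"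
  using assms
proof (induction "card A" arbitrary: A rule: less_induct)
  case less
  have "A \<noteq> {}"
    using less.prems by auto
  define M where "M = Max A"
  have M: "M \<in> A" "\<And>x. x \<in> A \<Longrightarrow> x \<le> M"
    using less.prems \<open>A \<noteq> {}\<close> by (auto simp: M_def)
  show ?case
  proof (cases "card A = 2")
    case True
    have "peak_lists {1} A = {}"
      using length_peak_lists[of _ "{1}" A] list_peaks_short True
      by (fastforce simp: peak_lists_def)
    then show ?thesis
      using True by simp
  next
    case False
    let ?f = "\<lambda>a vs. a # M # vs" and ?g = "\<lambda>us. us @ [M]"
    let ?A = "A - {M}"
    let ?P = "\<lambda>a. peak_lists {} (?A - {a})" and ?Q = "peak_lists {1} ?A"
    have cA: "card ?A = card A - 1" "finite ?A"
      using less.prems M by auto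
    have cAa: "card (?A - {a}) = card A - 2" if "a \<in> ?A" for a
      using that cA by simp
    have IH: "card ?Q = (card A - 3) * 2 ^ (card A - 3)"
    proof -
      have "card ?Q = (card ?A - 2) * 2 ^ (card ?A - 2)"
        using less.prems cA False by (intro less.hyps) auto
      then show ?thesis
        unfolding cA(1) by (simp add: numeral_eq_Suc)
    qed
    have split: "peak_lists {1} A = (\<Union>a\<in>?A. ?f a ` ?P a) \<union> ?g ` ?Q"
    proof (intro equalityI subsetI)
      fix xs
      assume "xs \<in> peak_lists {1} A"
      from peak_lists_splitE[OF this M] obtain us vs where
        s: "xs = us @ M # vs" "distinct us" "distinct vs" "set us \<inter> set vs = {}"
          "M \<notin> set us \<union> set vs" "A = insert M (set us \<union> set vs)"
          "{1} = list_peaks us \<union> (if us \<noteq> [] \<and> vs \<noteq> [] then {length us} else {}) \<union>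
            (\<lambda>i. i + length us + 1) ` list_peaks vs"
        by metis
      consider "us = []" | "vs = []" | "us \<noteq> []" "vs \<noteq> []"
        by blast
      then show "xs \<in> (\<Union>a\<in>?A. ?f a ` ?P a) \<union> ?g ` ?Q"
      proof cases
        case 1
        \<comment> \<open>Positions in \<open>vs\<close> are shifted by 1 here, but the first letter
          of \<open>vs\<close> is no peak.\<close>
        then have "0 \<in> list_peaks vs"
          using s(7) by (auto simp: list_peaks_short)
        then show ?thesis
          by (auto dest: list_peaks_bounds)
      next
        case 2
        then have "list_peaks us = {1}"
          using s(7) by (simp add: list_peaks_short)
        then show ?thesis
          using 2 s by (auto simp: peak_lists_def)
      next
        case 3
        then have "length us = 1"
          using s(7) by auto
        then obtain a where a: "us = [a]"
          by (auto simp: length_Suc_conv)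
        \<comment> \<open>A peak \<open>i\<close> of \<open>vs\<close> would sit at
          \<open>i + 2\<close> in the whole word, which is never 1, so this holds vacuously.\<close>
        have "i = 0" if "i \<in> list_peaks vs" for i
          using that s(7) a by auto
        then have "list_peaks vs = {}"
          by (auto dest: list_peaks_bounds)
        then have "vs \<in> ?P a" "a \<in> ?A"
          using s a by (auto simp: peak_lists_def)
        then show ?thesis
          using s(1) a by auto
      qed
    next
      fix xs
      assume "xs \<in> (\<Union>a\<in>?A. ?f a ` ?P a) \<union> ?g ` ?Q"
      then consider a vs where "a \<in> ?A" "vs \<in> ?P a" "xs = [a] @ M # vs"
        | us where "us \<in> ?Q" "xs = us @ M # []"
        by auto
      then show "xs \<in> peak_lists {1} A"
      proof cases
        case 1
        \<comment> \<open>A nonempty \<open>vs\<close> makes \<open>M\<close> an interior letter,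
          hence a peak.\<close>
        have "vs \<noteq> []"
          using length_peak_lists[OF 1(2)] cAa[OF 1(1)] less.prems False by auto
        then show ?thesis
          unfolding 1(3) using 1 M
          by (intro peak_lists_joinI) (auto simp: peak_lists_def list_peaks_short)
      next
        case 2
        then show ?thesis
          unfolding 2(2) using M
          by (intro peak_lists_joinI) (auto simp: peak_lists_def list_peaks_short)
      qed
    qed
    have "(\<Union>a\<in>?A. ?f a ` ?P a) \<inter> ?g ` ?Q = {}"
    proof -
      \<comment> \<open>As \<open>us\<close> has at least two letters, the equation would put
        \<open>M\<close> at position 1 of \<open>us\<close>.\<close>
      have "a # M # vs \<noteq> us @ [M]" if "us \<in> ?Q" for a us vs
      proof
        assume eq: "a # M # vs = us @ [M]"
        have us: "length us = card A - 1" "M \<notin> set us"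
          using length_peak_lists[OF that] cA that by (auto simp: peak_lists_def)
        then have "1 < length us"
          using less.prems False by auto
        then have "us ! 1 = (us @ [M]) ! 1"
          by (simp add: nth_append)
        also have "\<dots> = M"
          by (simp flip: eq)
        finally show False
          using us \<open>1 < length us\<close> nth_mem by metis
      qed
      then show ?thesis
        by blast
    qed
    then have "card (peak_lists {1} A) = card (\<Union>a\<in>?A. ?f a ` ?P a) + card (?g ` ?Q)"
      unfolding split by (intro card_Un_disjoint) (simp_all add: finite_peak_lists less.prems)
    moreover have "card (?g ` ?Q) = card ?Q"
      by (simp add: card_image inj_on_def)
    moreover have "card (\<Union>a\<in>?A. ?f a ` ?P a) = card ?A * 2 ^ (card A - 3)"
    proof (rule card_UN_image_inj)
      fix a
      assume a: "a \<in> ?A"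
      have "?A - {a} \<noteq> {}"
        using cAa[OF a] less.prems False by (metis card.empty diff_is_0_eq le_antisym)
      then have "card (?P a) = 2 ^ (card (?A - {a}) - 1)"
        using less.prems by (intro card_peak_lists_empty) auto
      then show "card (?P a) = 2 ^ (card A - 3)"
        unfolding cAa[OF a] by (simp add: numeral_eq_Suc)
    qed (use less.prems in \<open>auto intro: finite_peak_lists\<close>)
    ultimately have *: "card (peak_lists {1} A) =
        (card A - 1) * 2 ^ (card A - 3) + (card A - 3) * 2 ^ (card A - 3)"
      using IH cA by simp
    \<comment> \<open>Without truncated subtraction the recursion closes by
      \<open>(k + 2) + k = 2 * (k + 1)\<close>.\<close>
    obtain k where k: "card A = k + 3"
      using less.prems False by (metis le_add_diff_inverse2 le_neq_implies_less Suc_leI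
          eval_nat_numeral(3))
    show ?thesis
      unfolding * k by (simp add: algebra_simps)
  qed
qed

section \<open>Words with peaks at the second and penultimate positions\<close>

text \<open>Reversal exchanges the positions 1 and \<open>card A - 2\<close>. This carries the count
  of \<open>card_peak_lists_second\<close> over to a single penultimate peak.\<close>

lemma peak_lists_penultimate_eq:
  assumes "3 \<le> card A"
  shows "peak_lists {card A - 2} A = rev ` peak_lists {1} A"
proof (intro equalityI subsetI)
  fix xs
  assume xs: "xs \<in> peak_lists {card A - 2} A"
  have "list_peaks (rev xs) = {1}"
    using xs length_peak_lists[OF xs] assms by (auto simp: list_peaks_rev peak_lists_def)
  then have "rev xs \<in> peak_lists {1} A"
    using xs by (simp add: peak_lists_def)
  then show "xs \<in> rev ` peak_lists {1} A"
    by force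
next
  fix xs
  assume "xs \<in> rev ` peak_lists {1} A"
  then obtain ys where ys: "xs = rev ys" "ys \<in> peak_lists {1} A"
    by auto
  have "list_peaks xs = {card A - 2}"
    using ys length_peak_lists[OF ys(2)]
    by (simp add: list_peaks_rev peak_lists_def numeral_eq_Suc)
  then show "xs \<in> peak_lists {card A - 2} A"
    using ys by (simp add: peak_lists_def)
qed

lemma card_peak_lists_second_penultimate:
  assumes "finite A" "5 \<le> card A"
  shows "card (peak_lists {1, card A - 2} A) = (card A - 1) * (card A - 4) * 2 ^ (card A - 3)"
proof -
  have "A \<noteq> {}"
    using assms by auto
  define M where "M = Max A"
  have M: "M \<in> A" "\<And>x. x \<in> A \<Longrightarrow> x \<le> M"
    using assms \<open>A \<noteq> {}\<close> by (auto simp: M_def)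
  let ?f = "\<lambda>a vs. a # M # vs" and ?g = "\<lambda>a us. us @ [M, a]"
  let ?A = "A - {M}"
  \<comment> \<open>Behind \<open>a\<close> and \<open>M\<close> positions drop by 2, so the peak
    \<open>card A - 2\<close> becomes \<open>card A - 4\<close>, again the penultimate position of
    the shorter word.\<close>
  let ?P = "\<lambda>a. peak_lists {card A - 4} (?A - {a})" and ?Q = "\<lambda>a. peak_lists {1} (?A - {a})"
  have cAa: "card (?A - {a}) = card A - 2" if "a \<in> ?A" for a
    using that assms M by simp
  have split: "peak_lists {1, card A - 2} A = (\<Union>a\<in>?A. ?f a ` ?P a) \<union> (\<Union>a\<in>?A. ?g a ` ?Q a)"
  proof (intro equalityI subsetI)
    fix xs
    assume "xs \<in> peak_lists {1, card A - 2} A"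
    from peak_lists_splitE[OF this M] obtain us vs where
      s: "xs = us @ M # vs" "distinct us" "distinct vs" "set us \<inter> set vs = {}"
        "M \<notin> set us \<union> set vs" "A = insert M (set us \<union> set vs)"
        "length us + length vs + 1 = card A"
        "{1, card A - 2} = list_peaks us \<union> (if us \<noteq> [] \<and> vs \<noteq> [] then {length us} else {}) \<union>
          (\<lambda>i. i + length us + 1) ` list_peaks vs" .
    \<comment> \<open>If \<open>M\<close> came first, the peak 1 would have to be the first letter
      of \<open>vs\<close>.\<close>
    have "us \<noteq> []"
    proof
      assume "us = []"
      then have "{1, card A - 2} = (\<lambda>i. i + 1) ` list_peaks vs"
        using s(8) by (simp add: list_peaks_short)
      then have "1 \<in> (\<lambda>i. i + 1) ` list_peaks vs"
        by blast
      then show False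
        by (auto dest: list_peaks_bounds)
    qed
    \<comment> \<open>If \<open>M\<close> came last, the peak \<open>card A - 2\<close> would be the
      last letter of \<open>us\<close>.\<close>
    moreover have "vs \<noteq> []"
    proof
      assume "vs = []"
      then have "card A - 2 \<in> list_peaks us"
        using s(8) by (auto simp: list_peaks_short)
      then show False
        using list_peaks_bounds s(7) assms \<open>vs = []\<close> by fastforce
    qed
    ultimately have peaks: "{1, card A - 2} = list_peaks us \<union> {length us} \<union>
        (\<lambda>i. i + length us + 1) ` list_peaks vs"
      using s(8) by simp
    then consider "length us = 1" | "length us = card A - 2"
      by blast
    then show "xs \<in> (\<Union>a\<in>?A. ?f a ` ?P a) \<union> (\<Union>a\<in>?A. ?g a ` ?Q a)"
    proof cases
      case 1
      then obtain a where a: "us = [a]"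
        by (auto simp: length_Suc_conv)
      have eq: "{1, card A - 2} = {1} \<union> (\<lambda>i. i + 2) ` list_peaks vs"
        using peaks a by (simp add: list_peaks_short)
      \<comment> \<open>Shifted positions are at least 2, so the element 1 does not interfere:
        \<open>i\<close> is a peak of \<open>vs\<close> exactly if \<open>i + 2\<close> lies in the
        peak set.\<close>
      have "i \<in> list_peaks vs \<longleftrightarrow> i = card A - 4" for i
      proof -
        have "i \<in> list_peaks vs \<longleftrightarrow> i + 2 \<in> {1} \<union> (\<lambda>i. i + 2) ` list_peaks vs"
          by auto
        also have "\<dots> \<longleftrightarrow> i = card A - 4"
          unfolding eq[symmetric] using assms(2) by auto
        finally show ?thesis .
      qed
      then have "list_peaks vs = {card A - 4}"
        by auto
      then have "vs \<in> ?P a" "a \<in> ?A"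
        using s a by (auto simp: peak_lists_def)
      then show ?thesis
        using s(1) a by auto
    next
      case 2
      then have "length vs = 1"
        using s(7) assms(2) by simp
      then obtain a where a: "vs = [a]"
        by (auto simp: length_Suc_conv)
      have eq: "{1, card A - 2} = list_peaks us \<union> {card A - 2}"
        using peaks a 2 by (simp add: list_peaks_short)
      \<comment> \<open>This position is \<open>length us\<close>, outside \<open>us\<close>;
        removing it from the peak set leaves exactly \<open>list_peaks us\<close>.\<close>
      have "card A - 2 \<notin> list_peaks us"
        using list_peaks_bounds 2 by fastforce
      then have "list_peaks us = {1, card A - 2} - {card A - 2}"
        unfolding eq by auto
      also have "\<dots> = {1}"
        using assms(2) by auto
      finally have "us \<in> ?Q a" "a \<in> ?A"
        using s a by (auto simp: peak_lists_def)
      then show ?thesis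
        using s(1) a by auto
    qed
  next
    fix xs
    assume "xs \<in> (\<Union>a\<in>?A. ?f a ` ?P a) \<union> (\<Union>a\<in>?A. ?g a ` ?Q a)"
    then consider a vs where "a \<in> ?A" "vs \<in> ?P a" "xs = [a] @ M # vs"
      | a us where "a \<in> ?A" "us \<in> ?Q a" "xs = us @ M # [a]"
      by auto
    then show "xs \<in> peak_lists {1, card A - 2} A"
    proof cases
      case 1
      have "vs \<noteq> []"
        using length_peak_lists[OF 1(2)] cAa[OF 1(1)] assms by auto
      then show ?thesis
        unfolding 1(3) using 1 M assms(2)
        by (intro peak_lists_joinI) (auto simp: peak_lists_def list_peaks_short)
    next
      case 2
      have "length us = card A - 2"
        using length_peak_lists[OF 2(2)] cAa[OF 2(1)] by simp
      moreover from this have "us \<noteq> []"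
        using assms by auto
      ultimately show ?thesis
        unfolding 2(3) using 2 M
        by (intro peak_lists_joinI) (auto simp: peak_lists_def list_peaks_short)
    qed
  qed
  have "(\<Union>a\<in>?A. ?f a ` ?P a) \<inter> (\<Union>a\<in>?A. ?g a ` ?Q a) = {}"
  proof -
    \<comment> \<open>As \<open>us\<close> has at least three letters, \<open>M\<close> would occur
      in it at position 1.\<close>
    have "a # M # vs \<noteq> us @ [M, b]" if "b \<in> ?A" "us \<in> ?Q b" for a b us vs
    proof
      assume eq: "a # M # vs = us @ [M, b]"
      have us: "length us = card A - 2" "M \<notin> set us"
        using length_peak_lists[OF that(2)] cAa[OF that(1)] that by (auto simp: peak_lists_def)
      then have "1 < length us"
        using assms by auto
      then have "us ! 1 = (us @ [M, b]) ! 1"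
        by (simp add: nth_append)
      also have "\<dots> = M"
        by (simp flip: eq)
      finally show False
        using us \<open>1 < length us\<close> nth_mem by metis
    qed
    then show ?thesis
      by blast
  qed
  then have "card (peak_lists {1, card A - 2} A) =
      card (\<Union>a\<in>?A. ?f a ` ?P a) + card (\<Union>a\<in>?A. ?g a ` ?Q a)"
    unfolding split by (intro card_Un_disjoint) (simp_all add: finite_peak_lists assms)
  moreover have Q: "card (?Q a) = (card A - 4) * 2 ^ (card A - 4)" if a: "a \<in> ?A" for a
  proof -
    have "card (?Q a) = (card (?A - {a}) - 2) * 2 ^ (card (?A - {a}) - 2)"
      using assms cAa[OF a] by (intro card_peak_lists_second) auto
    then show ?thesis
      unfolding cAa[OF a] by (simp add: numeral_eq_Suc)
  qed
  moreover have P: "card (?P a) = (card A - 4) * 2 ^ (card A - 4)" if a: "a \<in> ?A" for a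
  proof -
    have "?P a = rev ` ?Q a"
      using peak_lists_penultimate_eq[of "?A - {a}"] assms(2) unfolding cAa[OF a]
      by (simp add: numeral_eq_Suc)
    then show ?thesis
      using Q[OF a] by (simp add: card_image)
  qed
  moreover have "card (\<Union>a\<in>?A. ?f a ` ?P a) = card ?A * ((card A - 4) * 2 ^ (card A - 4))"
    by (rule card_UN_image_inj) (use assms P in \<open>auto intro: finite_peak_lists\<close>)
  moreover have "card (\<Union>a\<in>?A. ?g a ` ?Q a) = card ?A * ((card A - 4) * 2 ^ (card A - 4))"
    by (rule card_UN_image_inj) (use assms Q in \<open>auto intro: finite_peak_lists\<close>)
  ultimately have *: "card (peak_lists {1, card A - 2} A) =
      2 * ((card A - 1) * ((card A - 4) * 2 ^ (card A - 4)))"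
    using M assms by simp
  \<comment> \<open>The factor 2 from the two mirror-image cases raises the exponent from
    \<open>card A - 4\<close> to \<open>card A - 3\<close>.\<close>
  obtain k where "card A = k + 5"
    using assms(2) by (metis le_add_diff_inverse2)
  then show ?thesis
    unfolding * by (simp add: algebra_simps numeral_eq_Suc)
qed

section \<open>From permutations to words\<close>

text \<open>Index \<open>i\<close> of the list holds the value at \<open>i + 1\<close>, which
  accounts for \<open>Suc\<close>.\<close>

lemma list_peaks_map_upt:
  "Suc ` list_peaks (map \<pi> [1..<n + 1]) = peaks n \<pi>"
proof (intro equalityI subsetI)
  fix i
  assume "i \<in> peaks n \<pi>"
  then have i: "1 < i" "i < n" "\<pi> (i - 1) < \<pi> i" "\<pi> i > \<pi> (i + 1)"
    by (auto simp: peaks_def)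
  \<comment> \<open>The left neighbour \<open>i - 1\<close> then has list index
    \<open>j\<close>.\<close>
  then obtain j where "i = Suc (Suc j)"
    by (metis One_nat_def less_imp_Suc_add plus_1_eq_Suc)
  with i have "i - 1 \<in> list_peaks (map \<pi> [1..<n + 1])" "i = Suc (i - 1)"
    by (auto simp: list_peaks_def simp del: upt_Suc)
  then show "i \<in> Suc ` list_peaks (map \<pi> [1..<n + 1])"
    by blast
qed (auto simp: peaks_def list_peaks_def simp del: upt_Suc)

lemma bij_betw_permutes_lists:
  "bij_betw (\<lambda>\<pi>. map \<pi> [1..<n + 1]) {\<pi>. \<pi> permutes {1..n}} {xs. distinct xs \<and> set xs = {1..n}}"
  unfolding bij_betw_def
proof (intro conjI equalityI subsetI)
  show "inj_on (\<lambda>\<pi>. map \<pi> [1..<n + 1]) {\<pi>. \<pi> permutes {1..n}}"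
  proof (rule inj_onI, rule ext)
    fix \<pi> \<sigma> i
    assume a: "\<pi> \<in> {\<pi>. \<pi> permutes {1..n}}" "\<sigma> \<in> {\<pi>. \<pi> permutes {1..n}}"
      and eq: "map \<pi> [1..<n + 1] = map \<sigma> [1..<n + 1]"
    show "\<pi> i = \<sigma> i"
    proof (cases "i \<in> {1..n}")
      case True
      then show ?thesis
        using eq by (simp add: map_eq_conv del: upt_Suc)
    next
      case False
      then show ?thesis
        using a by (simp add: permutes_not_in)
    qed
  qed
next
  fix xs
  assume "xs \<in> (\<lambda>\<pi>. map \<pi> [1..<n + 1]) ` {\<pi>. \<pi> permutes {1..n}}"
  then obtain \<pi> where \<pi>: "\<pi> permutes {1..n}" and xs: "xs = map \<pi> [1..<n + 1]"
    by auto
  have "set xs = \<pi> ` {1..n}"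
    by (auto simp: xs simp del: upt_Suc)
  then show "xs \<in> {xs. distinct xs \<and> set xs = {1..n}}"
    using permutes_image[OF \<pi>] permutes_inj_on[OF \<pi>]
    by (simp add: xs distinct_map del: upt_Suc)
next
  fix xs
  assume "xs \<in> {xs. distinct xs \<and> set xs = {1..n}}"
  then have xs: "distinct xs" "set xs = {1..n}"
    by auto
  then have len: "length xs = n"
    using distinct_card[of xs] by simp
  \<comment> \<open>\<open>permutes\<close> demands the identity outside
    \<open>{1..n}\<close>.\<close>
  define \<pi> where "\<pi> i = (if i \<in> {1..n} then xs ! (i - 1) else i)" for i
  have map: "map \<pi> [1..<n + 1] = xs"
    by (rule nth_equalityI) (auto simp: \<pi>_def len simp del: upt_Suc)
  have "\<pi> ` {1..n} = set (map \<pi> [1..<n + 1])"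
    by (auto simp del: upt_Suc)
  then have img: "\<pi> ` {1..n} = {1..n}"
    unfolding map xs(2) .
  \<comment> \<open>A map of a finite set onto itself is injective.\<close>
  then have "inj_on \<pi> {1..n}"
    by (intro eq_card_imp_inj_on) auto
  then have "\<pi> permutes {1..n}"
    using img by (intro bij_imp_permutes) (auto simp: bij_betw_def \<pi>_def)
  then show "xs \<in> (\<lambda>\<pi>. map \<pi> [1..<n + 1]) ` {\<pi>. \<pi> permutes {1..n}}"
    using map by blast
qed

lemma card_peak_perms_eq:
  "card (peak_perms (Suc ` S) n) = card (peak_lists S {1..n})"
proof -
  let ?h = "\<lambda>\<pi>. map \<pi> [1..<n + 1]"
  \<comment> \<open>\<open>Suc\<close> is injective, so comparing shifted peak sets is comparing
    peak sets.\<close>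
  have iff: "list_peaks (?h \<pi>) = S \<longleftrightarrow> peaks n \<pi> = Suc ` S" for \<pi>
    by (simp add: list_peaks_map_upt[symmetric] inj_image_eq_iff del: upt_Suc)
  have "bij_betw ?h (peak_perms (Suc ` S) n) (peak_lists S {1..n})"
  proof (rule bij_betw_subset[OF bij_betw_permutes_lists])
    have "peak_lists S {1..n} = {xs \<in> ?h ` {\<pi>. \<pi> permutes {1..n}}. list_peaks xs = S}"
      unfolding bij_betw_imp_surj_on[OF bij_betw_permutes_lists] peak_lists_def by blast
    also have "\<dots> = ?h ` peak_perms (Suc ` S) n"
      using iff unfolding peak_perms_def by blast
    finally show "?h ` peak_perms (Suc ` S) n = peak_lists S {1..n}" ..
  qed (auto simp: peak_perms_def)
  then show ?thesis
    by (rule bij_betw_same_card)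
qed

lemma card_peak_perms_second_penultimate:
  assumes "5 \<le> n"
  shows "card (peak_perms {2, n - 1} n) = (n - 1) * (n - 4) * 2 ^ (n - 3)"
proof -
  have "{2, n - 1} = Suc ` {1, n - 2}"
    using assms by auto
  then have "card (peak_perms {2, n - 1} n) = card (peak_lists {1, n - 2} {1..n})"
    by (simp only: card_peak_perms_eq)
  then show ?thesis
    using card_peak_lists_second_penultimate[of "{1..n}"] assms by simp
qed

section \<open>Admissibility and the peak polynomial\<close>

lemma Suc_notin_peaks: "i \<in> peaks n \<pi> \<Longrightarrow> Suc i \<notin> peaks n \<pi>"
  by (auto simp: peaks_def)

text \<open>The two peaks would be adjacent. This settles \<open>n = 4\<close>, the only
  \<open>n\<close> below 5 with \<open>2 < n - 1\<close>.\<close>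

lemma peak_perms_2_3_4: "peak_perms {2, 3} 4 = {}"
  using Suc_notin_peaks[of 2 4] by (auto simp: peak_perms_def)

theorem theorem4p2:
  "(\<forall>n. 2 < n - 1 \<longrightarrow> (admissible {2, n - 1} n \<longleftrightarrow> 5 \<le> n)) \<and>
   (\<forall>n\<ge>5. card (peak_perms {2, n - 1} n) = (n - 1) * (n - 4) * 2 ^ (n - 3)) \<and>
   (\<forall>p. is_peak_polynomial {n. 2 < n - 1} (\<lambda>n. {2, n - 1}) p \<longleftrightarrow>
        p = [:- 1, 1:] * [:- 4, 1:])"
proof (intro conjI allI impI)
  fix n :: nat
  assume n: "2 < n - 1"
  show "admissible {2, n - 1} n \<longleftrightarrow> 5 \<le> n"
  proof (cases "n = 4")
    case True
    then show ?thesis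
      using peak_perms_2_3_4 by (simp add: admissible_def)
  next
    case False
    then have "5 \<le> n"
      using n by simp
    then have "card (peak_perms {2, n - 1} n) \<noteq> 0"
      unfolding card_peak_perms_second_penultimate[OF \<open>5 \<le> n\<close>] by simp
    then show ?thesis
      using \<open>5 \<le> n\<close> by (auto simp: admissible_def)
  qed
next
  fix n :: nat
  assume "5 \<le> n"
  then show "card (peak_perms {2, n - 1} n) = (n - 1) * (n - 4) * 2 ^ (n - 3)"
    by (rule card_peak_perms_second_penultimate)
next
  fix p :: "real poly"
  let ?q = "[:- 1, 1:] * [:- 4, 1:] :: real poly"
  have card_real: "real (card (peak_perms {2, n - 1} n)) = poly ?q (real n) * 2 ^ (n - 3)"
    if "5 \<le> n" for n
    unfolding card_peak_perms_second_penultimate[OF that]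
    using that by (simp add: of_nat_diff) (simp add: algebra_simps)
  \<comment> \<open>Here 2 and \<open>n - 1\<close> are distinct, so the peak set has two
    elements.\<close>
  have exponent: "n - card {2, n - 1} - 1 = n - 3" if "5 \<le> n" for n :: nat
    using that by (simp add: card_insert_if)
  show "is_peak_polynomial {n. 2 < n - 1} (\<lambda>n. {2, n - 1}) p \<longleftrightarrow> p = ?q"
  proof
    assume p: "is_peak_polynomial {n. 2 < n - 1} (\<lambda>n. {2, n - 1}) p"
    \<comment> \<open>The count is nonzero for these \<open>n\<close>, so the equation for
      \<open>p\<close> applies; agreement with \<open>?q\<close> at infinitely many integers then
      forces equality.\<close>
    have root: "poly (p - ?q) (real n) = 0" if "5 \<le> n" for n
    proof -
      have "card (peak_perms {2, n - 1} n) \<noteq> 0"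
        using that unfolding card_peak_perms_second_penultimate[OF that] by simp
      then have "poly p (real n) * 2 ^ (n - 3) = poly ?q (real n) * 2 ^ (n - 3)"
        using p that exponent[OF that] card_real[OF that] unfolding is_peak_polynomial_def by auto
      then show ?thesis
        by simp
    qed
    have "real ` {5..} \<subseteq> {x. poly (p - ?q) x = 0}"
      using root by blast
    moreover have "infinite (real ` {5..})"
      by (simp add: finite_image_iff infinite_Ici)
    ultimately have "p - ?q = 0"
      using poly_roots_finite finite_subset by blast
    then show "p = ?q"
      by simp
  next
    assume p: "p = ?q"
    show "is_peak_polynomial {n. 2 < n - 1} (\<lambda>n. {2, n - 1}) p"
      unfolding is_peak_polynomial_def
    proof (intro ballI impI)
      fix n :: nat
      assume "n \<in> {n. 2 < n - 1}" and nz: "card (peak_perms {2, n - 1} n) \<noteq> 0"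
      moreover have "n \<noteq> 4"
        using nz peak_perms_2_3_4 by auto
      ultimately have "5 \<le> n"
        by auto
      then show "real (card (peak_perms {2, n - 1} n)) =
          poly p (real n) * 2 ^ (n - card {2, n - 1} - 1)"
        unfolding p using card_real exponent by metis
    qed
  qed
qed

end
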